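(* The linearly ordered space $\omega_1+1$ (with the order topology) is not semi-Eberlein.
   Context: For a set $S$, $c_0(S)$ is the set of all $x\in\mathbb{R}^S$ such that for every $\varepsilon>0$ the set $\{s\in S : |x(s)|>\varepsilon\}$ is finite; $\mathbb{R}^S$ carries the product topology. A compact (Hausdorff) space $K$ is semi-Eberlein if for some set $S$ there is a topological embedding of $K$ into $\mathbb{R}^S$ such that, identifying $K$ with its image, $c_0(S)\cap K$ is dense in $K$. *)

theory Defs
  imports "HOL-Analysis.Analysis"
begin

section \<open>The linearly ordered space $\omega_1 + 1$\<close>

text \<open>
  The ordinal $\omega_1$ is the least uncountable cardinal, i.e. the cardinal successor of
  \<open>natLeq\<close>, with its well-order as type-class order.
\<close>

abbreviation omega1_rel :: "nat set rel" where
  "omega1_rel \<equiv> cardSuc natLeq"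

lemma Well_order_omega1_rel: "Well_order omega1_rel"
  using cardSuc_Card_order[OF natLeq_Card_order] by (simp add: card_order_on_def)

lemma Field_omega1_rel_nonempty: "Field omega1_rel \<noteq> {}"
proof
  assume "Field omega1_rel = {}"
  moreover have "infinite (Field omega1_rel)"
    using natLeq_Card_order by (simp add: cardSuc_finite Field_natLeq)
  ultimately show False by simp
qed

typedef omega1 = "Field omega1_rel"
  using Field_omega1_rel_nonempty by blast

instantiation omega1 :: wellorder
begin

definition less_eq_omega1 :: "omega1 \<Rightarrow> omega1 \<Rightarrow> bool" where
  "x \<le> y \<longleftrightarrow> (Rep_omega1 x, Rep_omega1 y) \<in> omega1_rel"

definition less_omega1 :: "omega1 \<Rightarrow> omega1 \<Rightarrow> bool" where
  "(x :: omega1) < y \<longleftrightarrow> x \<le> y \<and> \<not> y \<le> x"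

instance
proof
  have wo: "refl_on (Field omega1_rel) omega1_rel" "trans omega1_rel"
    "antisym omega1_rel" "total_on (Field omega1_rel) omega1_rel" "wf (omega1_rel - Id)"
    using Well_order_omega1_rel by (auto simp: order_on_defs)
  fix x y z :: omega1
  show "(x < y) = (x \<le> y \<and> \<not> y \<le> x)" by (simp add: less_omega1_def)
  show refl: "x \<le> x"
    using wo(1) Rep_omega1 by (auto simp: less_eq_omega1_def refl_on_def)
  show "x \<le> y \<Longrightarrow> y \<le> z \<Longrightarrow> x \<le> z"
    using wo(2) by (auto simp: less_eq_omega1_def dest: transD)
  show anti: "x \<le> y \<Longrightarrow> y \<le> x \<Longrightarrow> x = y"
    using wo(3) by (auto simp: less_eq_omega1_def Rep_omega1_inject dest: antisymD)
  show "x \<le> y \<or> y \<le> x"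
    using wo(4) refl Rep_omega1[of x] Rep_omega1[of y]
    by (cases "x = y") (auto simp: less_eq_omega1_def total_on_def Rep_omega1_inject)
  have "wf (inv_image (omega1_rel - Id) Rep_omega1)"
    using wo(5) by (rule wf_inv_image)
  moreover have "inv_image (omega1_rel - Id) Rep_omega1 = {(x, y). x < y}"
    using wo(3) by (auto simp: inv_image_def less_omega1_def less_eq_omega1_def
        Rep_omega1_inject dest: antisymD)
  ultimately have wf: "wf {(x :: omega1, y). x < y}" by simp
  fix P :: "omega1 \<Rightarrow> bool" and a
  show "(\<And>x. (\<And>y. y < x \<Longrightarrow> P y) \<Longrightarrow> P x) \<Longrightarrow> P a"
    using wf by (induction a rule: wf_induct_rule) auto
qed

end

text \<open>$\omega_1 + 1$ adds a largest point, the ordinal $\omega_1$ itself, called \<open>Omega1\<close>.\<close>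

datatype omega1_plus_1 = Below omega1 | Omega1

instantiation omega1_plus_1 :: wellorder
begin

fun less_eq_omega1_plus_1 :: "omega1_plus_1 \<Rightarrow> omega1_plus_1 \<Rightarrow> bool" where
  "Below a \<le> Below b \<longleftrightarrow> a \<le> b"
| "Omega1 \<le> Below b \<longleftrightarrow> False"
| "x \<le> Omega1 \<longleftrightarrow> True"

definition less_omega1_plus_1 :: "omega1_plus_1 \<Rightarrow> omega1_plus_1 \<Rightarrow> bool" where
  "(x :: omega1_plus_1) < y \<longleftrightarrow> x \<le> y \<and> \<not> y \<le> x"

instance
proof
  fix x y z :: omega1_plus_1
  show "(x < y) = (x \<le> y \<and> \<not> y \<le> x)" by (simp add: less_omega1_plus_1_def)
  show "x \<le> x" by (cases x) auto
  show "x \<le> y \<Longrightarrow> y \<le> z \<Longrightarrow> x \<le> z" by (cases x; cases y; cases z) auto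
  show "x \<le> y \<Longrightarrow> y \<le> x \<Longrightarrow> x = y" by (cases x; cases y) auto
  show "x \<le> y \<or> y \<le> x" by (cases x; cases y) auto
  fix P :: "omega1_plus_1 \<Rightarrow> bool" and a
  assume step: "\<And>x. (\<And>y. y < x \<Longrightarrow> P y) \<Longrightarrow> P x"
  have below: "P (Below b)" for b
  proof (induction b rule: less_induct)
    case (less b)
    show ?case
    proof (rule step)
      fix y assume "y < Below b"
      then show "P y"
        by (cases y) (auto simp: less_omega1_plus_1_def intro: less)
    qed
  qed
  have "P Omega1"
  proof (rule step)
    fix y assume "y < Omega1"
    then show "P y" by (cases y) (auto simp: less_omega1_plus_1_def below)
  qed
  with below show "P a" by (cases a) auto
qed

end

instantiation omega1_plus_1 :: linorder_topology
begin

definition open_omega1_plus_1 :: "omega1_plus_1 set \<Rightarrow> bool" where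
  "open_omega1_plus_1 = generate_topology (range (\<lambda>a. {..<a}) \<union> range (\<lambda>a. {a<..}))"

instance
  by standard (simp add: open_omega1_plus_1_def)

end

text \<open>
  This space is compact (and Hausdorff, by its type class), so the question whether it is
  semi-Eberlein is meaningful.
\<close>

lemma compact_omega1_plus_1: "compact (UNIV :: omega1_plus_1 set)"
proof (rule compactI)
  fix C :: "omega1_plus_1 set set"
  assume op: "\<forall>t\<in>C. open t" and cov: "UNIV \<subseteq> \<Union>C"
  have "\<exists>D. D \<subseteq> C \<and> finite D \<and> {..x} \<subseteq> \<Union>D" for x
  proof (induction x rule: less_induct)
    case (less x)
    obtain U where U: "U \<in> C" "x \<in> U" using cov by blast
    show ?case
    proof (cases "\<exists>y. y < x")
      case True
      then obtain b where b: "b < x" "{b<..x} \<subseteq> U"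
        using open_left[of U x] op U by blast
      obtain D where D: "D \<subseteq> C" "finite D" "{..b} \<subseteq> \<Union>D" using less[OF b(1)] by blast
      have "{..x} \<subseteq> {..b} \<union> {b<..x}" by auto
      then have "{..x} \<subseteq> \<Union>(insert U D)" using b D by blast
      then show ?thesis using D U by (intro exI[of _ "insert U D"]) auto
    next
      case False
      then have "{..x} \<subseteq> {x}" by (auto simp: not_less intro: antisym)
      then show ?thesis using U by (intro exI[of _ "{U}"]) auto
    qed
  qed
  from this[of Omega1] obtain D where "D \<subseteq> C" "finite D" "{..Omega1} \<subseteq> \<Union>D" by blast
  moreover have "{..Omega1} = UNIV" by auto
  ultimately show "\<exists>D\<subseteq>C. finite D \<and> UNIV \<subseteq> \<Union>D" by auto
qed


section \<open>Semi-Eberlein spaces\<close>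

text \<open>
  Elements of $\mathbb{R}^S$ are the points of \<open>powertop_real S\<close>, i.e. functions that are
  \<open>undefined\<close> outside \<open>S\<close>.
\<close>

definition c0 :: "'s set \<Rightarrow> ('s \<Rightarrow> real) set" where
  "c0 S = {x \<in> S \<rightarrow>\<^sub>E UNIV. \<forall>\<epsilon>>0. finite {s \<in> S. \<bar>x s\<bar> > \<epsilon>}}"

text \<open>
  HOL cannot quantify over types inside a formula, so the type from which the index set \<open>S\<close> is
  drawn is a parameter. A space is semi-Eberlein if this holds for some type \<open>'s\<close>; it is
  not semi-Eberlein if \<open>\<not> semi_Eberlein TYPE('s) K\<close> holds with a free type variable \<open>'s\<close>.
\<close>

definition semi_Eberlein :: "'s itself \<Rightarrow> 'a topology \<Rightarrow> bool" where
  "semi_Eberlein _ K \<longleftrightarrow> compact_space K \<and> Hausdorff_space K \<and>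
     (\<exists>(S :: 's set) f. embedding_map K (powertop_real S) f \<and>
        (let K' = f ` topspace K
         in subtopology (powertop_real S) K' closure_of (c0 S \<inter> K') = K'))"

end

theory Submission
  imports Defs "HOL-Library.Countable_Set_Type"
begin

text \<open>
  The point \<open>Omega1\<close> is a non-isolated P-point: a countable intersection of neighbourhoods is
  again a neighbourhood. Let $f$ embed a space with such a point $p$ into $\mathbb{R}^S$ with
  $c_0(S)$ dense in the image. Every coordinate of $f$ is constant near $p$, and so is any countable
  family of coordinates simultaneously. Hence $f(p) \in c_0(S)$: infinitely many large coordinates of
  $f(p)$ would be shared by a point of $c_0(S)$. In particular $f(p)$ has countable support, as does
  every point of $c_0(S)$, so one can recursively pick $x_n \neq p$ with $f(x_n) \in c_0(S)$ agreeing
  with $f(p)$ on the supports of $f(p)$ and of all earlier $f(x_i)$. Then $x_n \to p$, which is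
  impossible for a P-point.
\<close>

section \<open>P-points and continuous real functions\<close>

text \<open>Only a neighbourhood inside the intersection is required, not openness of the
  intersection. Isolated points qualify too, so being isolated can be derived as a conclusion about
  P-points.\<close>

definition P_point_of :: "'a topology \<Rightarrow> 'a \<Rightarrow> bool" where
  "P_point_of X p \<longleftrightarrow> p \<in> topspace X \<and>
     (\<forall>U :: nat \<Rightarrow> 'a set. (\<forall>n. openin X (U n) \<and> p \<in> U n) \<longrightarrow>
        (\<exists>V. openin X V \<and> p \<in> V \<and> V \<subseteq> (\<Inter>n. U n)))"

lemma P_point_of_countable:
  assumes "P_point_of X p" and "countable A"
    and U: "\<And>a. a \<in> A \<Longrightarrow> openin X (U a) \<and> p \<in> U a"
  obtains V where "openin X V" "p \<in> V" "\<And>a. a \<in> A \<Longrightarrow> V \<subseteq> U a"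
proof (cases "A = {}")
  case True
  then show ?thesis using that[of "topspace X"] assms(1) by (auto simp: P_point_of_def)
next
  case False
  define W where "W = (\<lambda>n. U (from_nat_into A n))"
  have "\<forall>n. openin X (W n) \<and> p \<in> W n"
    using U from_nat_into[OF False] by (auto simp: W_def)
  then obtain V where V: "openin X V" "p \<in> V" "V \<subseteq> (\<Inter>n. W n)"
    using assms(1) unfolding P_point_of_def by blast
  have "V \<subseteq> U a" if "a \<in> A" for a
  proof -
    have "V \<subseteq> W (to_nat_on A a)" using V(3) by blast
    then show ?thesis using that assms(2) by (simp add: W_def)
  qed
  then show ?thesis using that V by blast
qed

text \<open>The singleton of \<open>g p\<close> is the intersection of the balls of radius
  \<open>1 / Suc n\<close>, so \<open>g\<close> is constant on any neighbourhood of \<open>p\<close>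
  inside all their preimages.\<close>

lemma P_point_of_real_locally_constant:
  fixes g :: "'a \<Rightarrow> real"
  assumes P: "P_point_of X p" and g: "continuous_map X euclideanreal g"
  obtains V where "openin X V" "p \<in> V" "\<And>x. x \<in> V \<Longrightarrow> g x = g p"
proof -
  define U where "U = (\<lambda>n::nat. {x \<in> topspace X. g x \<in> ball (g p) (1 / Suc n)})"
  have "openin X (U n) \<and> p \<in> U n" for n
    using openin_continuous_map_preimage[OF g, of "ball (g p) (1 / Suc n)"] P
    by (auto simp: U_def P_point_of_def)
  then obtain V where V: "openin X V" "p \<in> V" "V \<subseteq> (\<Inter>n. U n)"
    using P unfolding P_point_of_def by blast
  have "g x = g p" if "x \<in> V" for x
  proof (rule ccontr)
    assume "g x \<noteq> g p"
    then obtain n where "1 / Suc n < dist (g p) (g x)"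
      using nat_approx_posE[of "dist (g p) (g x)"] by auto
    moreover have "x \<in> U n" using V(3) that by blast
    ultimately show False by (simp add: U_def)
  qed
  then show ?thesis using that V by blast
qed

text \<open>Each coordinate in \<open>A\<close> is constant on some neighbourhood of
  \<open>p\<close>; countably many such neighbourhoods have a common refinement.\<close>

lemma P_point_of_powertop_locally_constant:
  assumes P: "P_point_of X p" and f: "continuous_map X (powertop_real S) f"
    and "countable A" "A \<subseteq> S"
  obtains V where "openin X V" "p \<in> V" "\<And>x s. x \<in> V \<Longrightarrow> s \<in> A \<Longrightarrow> f x s = f p s"
proof -
  have "\<exists>V. openin X V \<and> p \<in> V \<and> (\<forall>x\<in>V. f x s = f p s)" if "s \<in> A" for s
  proof -
    have "continuous_map X euclideanreal (\<lambda>x. f x s)"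
      using f that assms(4) by (auto simp: continuous_map_componentwise)
    from P_point_of_real_locally_constant[OF P this] show ?thesis by metis
  qed
  then obtain U where U: "\<And>s. s \<in> A \<Longrightarrow> openin X (U s) \<and> p \<in> U s \<and> (\<forall>x\<in>U s. f x s = f p s)"
    by metis
  obtain V where V: "openin X V" "p \<in> V" "\<And>s. s \<in> A \<Longrightarrow> V \<subseteq> U s"
    using P_point_of_countable[OF P assms(3), of U] U by blast
  show ?thesis
    by (rule that[OF V(1,2)]) (use U V(3) in blast)
qed

section \<open>P-points of semi-Eberlein spaces\<close>

text \<open>The support is a countable union of the finite sets where the absolute value exceeds
  \<open>1 / Suc n\<close>.\<close>

lemma c0_countable_support:
  assumes "x \<in> c0 S"
  shows "countable {s \<in> S. x s \<noteq> 0}"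
proof -
  have "{s \<in> S. x s \<noteq> 0} \<subseteq> (\<Union>n::nat. {s \<in> S. \<bar>x s\<bar> > 1 / Suc n})"
  proof
    fix s assume s: "s \<in> {s \<in> S. x s \<noteq> 0}"
    then obtain n where "1 / Suc n < \<bar>x s\<bar>"
      using nat_approx_posE[of "\<bar>x s\<bar>"] by auto
    with s show "s \<in> (\<Union>n::nat. {s \<in> S. \<bar>x s\<bar> > 1 / Suc n})" by auto
  qed
  moreover have "finite {s \<in> S. \<bar>x s\<bar> > 1 / Suc n}" for n :: nat
    using assms by (simp add: c0_def)
  then have "countable (\<Union>n::nat. {s \<in> S. \<bar>x s\<bar> > 1 / Suc n})"
    by (simp add: countable_finite)
  ultimately show ?thesis by (rule countable_subset)
qed

text \<open>The image of \<open>U\<close> is nonempty and relatively open in the image of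
  \<open>X\<close>, hence meets the dense set.\<close>

lemma embedding_map_dense_preimage:
  assumes f: "embedding_map X Y f"
    and dense: "subtopology Y (f ` topspace X) closure_of (C \<inter> f ` topspace X) = f ` topspace X"
    and U: "openin X U" "U \<noteq> {}"
  shows "\<exists>x\<in>U. f x \<in> C"
proof -
  let ?Z = "subtopology Y (f ` topspace X)"
  have hom: "homeomorphic_map X ?Z f"
    using f by (simp add: embedding_map_def)
  obtain x where x: "x \<in> U" using U by blast
  have sub: "U \<subseteq> topspace X" using U(1) by (rule openin_subset)
  have op: "openin ?Z (f ` U)"
    using homeomorphic_map_openness[OF hom sub] U(1) by simp
  have "f x \<in> ?Z closure_of (C \<inter> f ` topspace X)" using dense x sub by auto
  then obtain y where y: "y \<in> C \<inter> f ` topspace X" "y \<in> f ` U"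
    using op x unfolding in_closure_of by blast
  then show ?thesis by auto
qed

theorem semi_Eberlein_P_point_isolated:
  assumes "semi_Eberlein TYPE('s) X" and P: "P_point_of X p"
  shows "openin X {p}"
proof (rule ccontr)
  assume not_isolated: "\<not> openin X {p}"
  obtain S :: "'s set" and f where f: "embedding_map X (powertop_real S) f"
    and dense: "subtopology (powertop_real S) (f ` topspace X) closure_of
                  (c0 S \<inter> f ` topspace X) = f ` topspace X"
    using assms(1) by (auto simp: semi_Eberlein_def Let_def)
  have t1: "t1_space X"
    using assms(1) by (simp add: semi_Eberlein_def Hausdorff_imp_t1_space)
  have p: "p \<in> topspace X" using P by (simp add: P_point_of_def)
  have cont: "continuous_map X (powertop_real S) f"
    using f by (auto simp: embedding_map_def continuous_map_in_subtopology
        dest: homeomorphic_imp_continuous_map)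
  have in_ext: "f x \<in> S \<rightarrow>\<^sub>E UNIV" if "x \<in> topspace X" for x
    using continuous_map_image_subset_topspace[OF cont] that by auto
  have ex: "\<exists>x. x \<in> topspace X \<and> x \<noteq> p \<and> f x \<in> c0 S \<and> (\<forall>s\<in>A. f x s = f p s)"
    if A: "countable A" "A \<subseteq> S" for A
  proof -
    obtain V where V: "openin X V" "p \<in> V" "\<And>x s. x \<in> V \<Longrightarrow> s \<in> A \<Longrightarrow> f x s = f p s"
      using P_point_of_powertop_locally_constant[OF P cont A] by blast
    \<comment> \<open>Removing \<open>p\<close> keeps the set open because points are closed, and
      leaves it nonempty because \<open>p\<close> is not isolated. Density then applies to
      it.\<close>
    have "openin X (V - {p})"
      using V(1) t1 p by (simp add: openin_diff closedin_t1_singleton)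
    moreover have "V - {p} \<noteq> {}"
    proof
      assume "V - {p} = {}"
      then have "V = {p}" using V(2) by blast
      then show False using V(1) not_isolated by simp
    qed
    ultimately obtain x where "x \<in> V - {p}" "f x \<in> c0 S"
      using embedding_map_dense_preimage[OF f dense] by blast
    then show ?thesis using V openin_subset[OF V(1)] by blast
  qed
  have fp: "f p \<in> c0 S"
  proof -
    have "finite {s \<in> S. \<bar>f p s\<bar> > \<epsilon>}" if "\<epsilon> > 0" for \<epsilon>
    proof (rule ccontr)
      assume "infinite {s \<in> S. \<bar>f p s\<bar> > \<epsilon>}"
      \<comment> \<open>Agreement with \<open>f p\<close> is available only on countable sets of
        coordinates, so the infinite set is first cut down to a countable one.\<close>
      then obtain F where F: "countable F" "infinite F" "F \<subseteq> {s \<in> S. \<bar>f p s\<bar> > \<epsilon>}"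
        using infinite_countable_subset'[of "{s \<in> S. \<bar>f p s\<bar> > \<epsilon>}"] by blast
      then obtain x where x: "f x \<in> c0 S" "\<forall>s\<in>F. f x s = f p s" using ex[of F] by blast
      have "F \<subseteq> {s \<in> S. \<bar>f x s\<bar> > \<epsilon>}" using F x by auto
      moreover have "finite {s \<in> S. \<bar>f x s\<bar> > \<epsilon>}" using x(1) that by (simp add: c0_def)
      ultimately show False using F(2) finite_subset by blast
    qed
    then show ?thesis using in_ext[OF p] by (simp add: c0_def)
  qed
  define supp where "supp = (\<lambda>x. {s \<in> S. f x s \<noteq> 0})"
  obtain h where h: "\<And>A. countable A \<Longrightarrow> A \<subseteq> S \<Longrightarrow>
      h A \<in> topspace X \<and> h A \<noteq> p \<and> f (h A) \<in> c0 S \<and> (\<forall>s\<in>A. f (h A) s = f p s)"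
    using ex by metis
  \<comment> \<open>\<open>A n\<close> collects the support of \<open>f p\<close> and those of the
    first \<open>n\<close> points of the sequence; the next point \<open>h (A n)\<close> agrees with
    \<open>p\<close> on all of them.\<close>
  define A where "A = rec_nat (supp p) (\<lambda>_ B. B \<union> supp (h B))"
  have A_simps: "A 0 = supp p" "A (Suc n) = A n \<union> supp (h (A n))" for n
    by (simp_all add: A_def)
  have A: "countable (A n) \<and> A n \<subseteq> S" for n
  proof (induction n)
    case 0
    then show ?case using c0_countable_support[OF fp] by (auto simp: A_simps supp_def)
  next
    case (Suc n)
    then have "countable (supp (h (A n)))"
      using h c0_countable_support unfolding supp_def by blast
    then show ?case using Suc by (auto simp: A_simps supp_def)
  qed
  have mono: "A m \<subseteq> A n" if "m \<le> n" for m n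
    using that by (induction rule: dec_induct) (auto simp: A_simps)
  define x where "x = (\<lambda>n. h (A n))"
  have x: "x n \<in> topspace X" "x n \<noteq> p" "\<And>s. s \<in> A n \<Longrightarrow> f (x n) s = f p s" for n
    using h A by (auto simp: x_def)
  have "limitin (powertop_real S) (\<lambda>n. f (x n)) (f p) sequentially"
  proof -
    have "\<forall>\<^sub>F n in sequentially. f (x n) s = f p s" if "s \<in> S" for s
    proof (cases "\<exists>k. s \<in> A k")
      case True
      then obtain k where "s \<in> A k" ..
      then have "f (x n) s = f p s" if "n \<ge> k" for n using x(3) mono that by blast
      then show ?thesis by (auto simp: eventually_sequentially)
    next
      case False
      \<comment> \<open>\<open>A 0\<close> is the support of \<open>f p\<close>, and
        \<open>A (Suc n)\<close> contains that of \<open>f (x n)\<close>, so both values at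
        \<open>s\<close> are 0.\<close>
      have "s \<notin> A 0" "s \<notin> A (Suc n)" for n using False by blast+
      then have "f (x n) s = f p s" for n
        using that by (auto simp: A_simps supp_def x_def)
      then show ?thesis by simp
    qed
    then have "((\<lambda>n. f (x n) s) \<longlongrightarrow> f p s) sequentially" if "s \<in> S" for s
      using that by (blast intro: tendsto_eventually)
    then show ?thesis
      using in_ext p x(1) by (simp add: limitin_componentwise PiE_iff)
  qed
  \<comment> \<open>The complements of the points \<open>x n\<close> are countably many
    neighbourhoods of \<open>p\<close>, so some neighbourhood of \<open>p\<close> misses the whole
    sequence.\<close>
  moreover obtain V where V: "openin X V" "p \<in> V" "\<And>n. x n \<notin> V"
  proof -
    have "openin X (topspace X - {x n}) \<and> p \<in> topspace X - {x n}" for n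
      using t1 x(1,2)[of n] p by (auto simp: openin_diff closedin_t1_singleton)
    then obtain V where "openin X V" "p \<in> V" "V \<subseteq> (\<Inter>n. topspace X - {x n})"
      using P unfolding P_point_of_def by meson
    then show ?thesis using that by blast
  qed
  moreover obtain W where W: "openin (powertop_real S) W" "f ` V = W \<inter> f ` topspace X"
  proof -
    have "openin (subtopology (powertop_real S) (f ` topspace X)) (f ` V)"
      using f[unfolded embedding_map_def] openin_subset[OF V(1)] V(1)
      by (simp add: homeomorphic_map_openness)
    then show ?thesis using that by (auto simp: openin_subtopology)
  qed
  ultimately have "\<forall>\<^sub>F n in sequentially. f (x n) \<in> W"
    by (auto simp: limitin_def)
  then obtain n where "f (x n) \<in> W" by (auto simp: eventually_sequentially)
  then have "f (x n) \<in> f ` V" using W(2) x(1) by blast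
  moreover have "inj_on f (topspace X)"
    using f by (simp add: embedding_map_def homeomorphic_eq_everything_map)
  ultimately show False
    using V x(1)[of n] openin_subset[OF V(1)] by (auto simp: inj_on_def)
qed

section \<open>Order and topology near the top of omega_1 + 1\<close>

lemma uncountable_omega1:
  includes cardinal_syntax
  shows "uncountable (UNIV :: omega1 set)"
proof
  assume "countable (UNIV :: omega1 set)"
  then have "countable (Field omega1_rel)"
    using countable_image[of UNIV Rep_omega1]
      type_definition.Rep_range[OF type_definition_omega1] by simp
  then have "|Field omega1_rel| \<le>o natLeq" by (simp add: countable_card_le_natLeq)
  moreover have "|Field omega1_rel| =o omega1_rel"
    by (intro card_of_Field_ordIso cardSuc_Card_order natLeq_Card_order)
  moreover have "natLeq <o omega1_rel" by (intro cardSuc_greater natLeq_Card_order)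
  ultimately show False
    using not_ordLess_ordLeq ordIso_symmetric ordIso_ordLeq_trans by fast
qed

text \<open>A proper initial segment of a cardinal has smaller cardinality, and below
  \<open>cardSuc natLeq\<close> this means at most \<open>natLeq\<close>.\<close>

lemma countable_lessThan_omega1:
  includes cardinal_syntax
  shows "countable {..<a :: omega1}"
proof -
  have "|underS omega1_rel (Rep_omega1 a)| <o omega1_rel"
    by (intro card_of_underS cardSuc_Card_order natLeq_Card_order Rep_omega1)
  then have "countable (underS omega1_rel (Rep_omega1 a))"
    by (simp add: countable_card_le_natLeq
        cardSuc_ordLeq_ordLess[OF natLeq_Card_order card_of_Card_order, symmetric])
  moreover have "Rep_omega1 ` {..<a} \<subseteq> underS omega1_rel (Rep_omega1 a)"
    by (auto simp: underS_def less_omega1_def less_eq_omega1_def Rep_omega1_inject)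
  ultimately have "countable (Rep_omega1 ` {..<a})" by (rule countable_subset[rotated])
  then show ?thesis
    by (rule countable_image_inj_on) (simp add: inj_on_def Rep_omega1_inject)
qed

text \<open>An unbounded sequence would cover \<open>omega1\<close> by countably many countable
  initial segments.\<close>

lemma omega1_sequence_bounded:
  fixes b :: "nat \<Rightarrow> omega1"
  shows "\<exists>c. \<forall>n. b n < c"
proof (rule ccontr)
  assume "\<not> (\<exists>c. \<forall>n. b n < c)"
  then have "UNIV \<subseteq> (\<Union>n. insert (b n) {..<b n})" by (fastforce simp: not_less order_le_less)
  moreover have "countable (\<Union>n. insert (b n) {..<b n})"
    by (simp add: countable_lessThan_omega1)
  ultimately show False using uncountable_omega1 countable_subset by blast
qed

lemma Below_less_iff [simp]: "Below a < Below b \<longleftrightarrow> a < b"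
  by (simp add: less_omega1_plus_1_def less_le_not_le)

lemma Below_less_Omega1 [simp]: "Below a < Omega1"
  by (simp add: less_omega1_plus_1_def)

lemma open_nhd_Omega1:
  assumes "open U" "Omega1 \<in> U"
  shows "\<exists>b. {Below b<..} \<subseteq> U"
proof -
  obtain b where b: "b < Omega1" "{b<..Omega1} \<subseteq> U"
    \<comment> \<open>\<open>Below undefined\<close> serves only as some point to the left of
      \<open>Omega1\<close>.\<close>
    using open_left[OF assms, of "Below undefined"] by auto
  moreover have "x \<le> Omega1" for x by simp
  then have "{b<..Omega1} = {b<..}" by auto
  ultimately have "{b<..} \<subseteq> U" by simp
  then show ?thesis using b(1) by (cases b) auto
qed

text \<open>Each neighbourhood contains a tail; a common strict bound of the countably many starting
  points gives one tail inside them all.\<close>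

lemma P_point_of_Omega1: "P_point_of euclidean Omega1"
  unfolding P_point_of_def
proof (intro conjI allI impI)
  fix U :: "nat \<Rightarrow> omega1_plus_1 set"
  assume "\<forall>n. openin euclidean (U n) \<and> Omega1 \<in> U n"
  then have "\<forall>n. \<exists>b. {Below b<..} \<subseteq> U n" using open_nhd_Omega1 by simp
  then obtain b where b: "\<And>n. {Below (b n)<..} \<subseteq> U n" by metis
  obtain c where "\<And>n. b n < c" using omega1_sequence_bounded by blast
  then have "Below (b n) < Below c" for n by simp
  then have "{Below c<..} \<subseteq> {Below (b n)<..}" for n
    by (meson greaterThan_subset_iff less_imp_le)
  then have "{Below c<..} \<subseteq> (\<Inter>n. U n)" using b by (meson INT_greatest order_trans)
  then show "\<exists>V. openin euclidean V \<and> Omega1 \<in> V \<and> V \<subseteq> (\<Inter>n. U n)"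
    by (intro exI[of _ "{Below c<..}"]) auto
qed simp

lemma Omega1_not_isolated: "\<not> open {Omega1}"
proof
  assume "open {Omega1}"
  then obtain b where b: "{Below b<..} \<subseteq> {Omega1}" using open_nhd_Omega1 by blast
  \<comment> \<open>Bounding a constant sequence shows that \<open>omega1\<close> has no greatest
    element.\<close>
  obtain c where "b < c" using omega1_sequence_bounded[of "\<lambda>_. b"] by blast
  then have "Below c \<in> {Below b<..}" by simp
  then show False using b by blast
qed

theorem corollary5p3:
  shows "\<not> semi_Eberlein TYPE('s) (euclidean :: omega1_plus_1 topology)"
  using semi_Eberlein_P_point_isolated[OF _ P_point_of_Omega1] Omega1_not_isolated by auto

end
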